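(* For every integer $h\ge1$: (a) $|DI_{2h}(3412,123)|=1+\binom{h}{2}$; (b) $|DI_{2h}(3412,312)|=2^{h-1}$.
   Context: $DI_n$ is the set of fixed point free involutions in the symmetric group $S_n$. A permutation $\sigma\in S_n$ contains the pattern $\pi\in S_k$ if there are $1\le i_1<\dots<i_k\le n$ such that $(\sigma(i_1),\dots,\sigma(i_k))$ is order-isomorphic to $\pi$; otherwise $\sigma$ avoids $\pi$. $DI_n(\pi_1,\pi_2)$ denotes the set of elements of $DI_n$ avoiding both $\pi_1$ and $\pi_2$. *)

theory Defs
  imports "HOL-Combinatorics.Permutations"
begin

text \<open>Elements of \<open>S\<^sub>n\<close> are functions that permute \<open>{1..n}\<close> (hence fix every number outside it).\<close>

definition DI :: "nat \<Rightarrow> (nat \<Rightarrow> nat) set" where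
  "DI n = {\<sigma>. \<sigma> permutes {1..n} \<and> \<sigma> \<circ> \<sigma> = id \<and> (\<forall>i\<in>{1..n}. \<sigma> i \<noteq> i)}"

text \<open>A pattern is given by its one-line notation, the list \<open>[\<pi>(1), \<dots>, \<pi>(k)]\<close>. The map \<open>i\<close> picks
  the positions of an occurrence; since list indices start at 0, \<open>i 0 < \<dots> < i (k - 1)\<close>
  are the positions usually written \<open>i\<^sub>1 < \<dots> < i\<^sub>k\<close>.\<close>

definition contains_pattern :: "nat \<Rightarrow> (nat \<Rightarrow> nat) \<Rightarrow> nat list \<Rightarrow> bool" where
  "contains_pattern n \<sigma> \<pi> \<longleftrightarrow>
     (\<exists>i. strict_mono_on {..<length \<pi>} i \<and> i ` {..<length \<pi>} \<subseteq> {1..n} \<and>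
          (\<forall>a<length \<pi>. \<forall>b<length \<pi>. \<sigma> (i a) < \<sigma> (i b) \<longleftrightarrow> \<pi> ! a < \<pi> ! b))"

definition avoids_pattern :: "nat \<Rightarrow> (nat \<Rightarrow> nat) \<Rightarrow> nat list \<Rightarrow> bool" where
  "avoids_pattern n \<sigma> \<pi> \<longleftrightarrow> \<not> contains_pattern n \<sigma> \<pi>"

definition DI_avoiding :: "nat \<Rightarrow> nat list \<Rightarrow> nat list \<Rightarrow> (nat \<Rightarrow> nat) set" where
  "DI_avoiding n \<pi>\<^sub>1 \<pi>\<^sub>2 = {\<sigma> \<in> DI n. avoids_pattern n \<sigma> \<pi>\<^sub>1 \<and> avoids_pattern n \<sigma> \<pi>\<^sub>2}"

end

theory Submission
  imports Defs
begin

text \<open>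
  A fixed point free involution is a perfect matching of \<open>{1..n}\<close>, and two crossing arcs
  form an occurrence of 3412. Both counts come from a complete description of the matchings
  in question as arrangements of intervals on which the permutation is the order-reversing map.
  Two facts produce these intervals: a decreasing self-map of an interval is its reversal
  (\<open>decreasing_self_map_is_reversal\<close>), and a reversed interval without a fixed point has
  even length.

  For the patterns 3412 and 123, strip off the outer arcs \<open>i \<leftrightarrow> 2h + 1 - i\<close>, as many as
  possible, say \<open>k\<close>. If anything is left, the point \<open>k + 1\<close> is matched to some \<open>q < 2h - k\<close>, and
  since arcs do not cross, \<open>{k<..q}\<close> and \<open>{q<..2h - k}\<close> are both invariant. An ascent inside one
  of them extends to an occurrence of 123 by a point of the other, so both are reversed. Hence
  the permutation is determined by \<open>k\<close> and the half-integer centre of the first interval, that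
  is, by a pair \<open>k < c < h\<close> with \<open>q = 2c - k\<close>; together with the full reversal this gives
  \<open>1 + (h choose 2)\<close>.

  For 3412 and 312, only 312 counts, because 3412 contains 312. If \<open>n\<close> is
  matched to \<open>m + 1\<close>, avoiding 312 forces \<open>{m<..n}\<close> to be invariant and reversed, and what
  remains is an arbitrary 312-avoiding matching of \<open>{1..m}\<close>. So the number for \<open>2h\<close> is the sum of
  the numbers for \<open>0, 2, \<dots>, 2h - 2\<close>, which doubles from \<open>h = 1\<close> on: these permutations
  correspond to the compositions of \<open>h\<close>.
\<close>

section \<open>Pattern occurrences as increasing lists of positions\<close>

lemma contains_pattern_iff_list:
  "contains_pattern n \<sigma> \<pi> \<longleftrightarrow>
     (\<exists>xs. length xs = length \<pi> \<and> sorted_wrt (<) xs \<and> set xs \<subseteq> {1..n} \<and>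
       (\<forall>a<length \<pi>. \<forall>b<length \<pi>. \<sigma> (xs ! a) < \<sigma> (xs ! b) \<longleftrightarrow> \<pi> ! a < \<pi> ! b))"
proof
  assume "contains_pattern n \<sigma> \<pi>"
  then obtain i where i: "strict_mono_on {..<length \<pi>} i" "i ` {..<length \<pi>} \<subseteq> {1..n}"
    "\<forall>a<length \<pi>. \<forall>b<length \<pi>. \<sigma> (i a) < \<sigma> (i b) \<longleftrightarrow> \<pi> ! a < \<pi> ! b"
    unfolding contains_pattern_def by blast
  show "\<exists>xs. length xs = length \<pi> \<and> sorted_wrt (<) xs \<and> set xs \<subseteq> {1..n} \<and>
       (\<forall>a<length \<pi>. \<forall>b<length \<pi>. \<sigma> (xs ! a) < \<sigma> (xs ! b) \<longleftrightarrow> \<pi> ! a < \<pi> ! b)"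
    using i by (intro exI[of _ "map i [0..<length \<pi>]"])
      (auto simp: sorted_wrt_iff_nth_less strict_mono_on_def)
next
  assume "\<exists>xs. length xs = length \<pi> \<and> sorted_wrt (<) xs \<and> set xs \<subseteq> {1..n} \<and>
       (\<forall>a<length \<pi>. \<forall>b<length \<pi>. \<sigma> (xs ! a) < \<sigma> (xs ! b) \<longleftrightarrow> \<pi> ! a < \<pi> ! b)"
  then obtain xs where xs: "length xs = length \<pi>" "sorted_wrt (<) xs" "set xs \<subseteq> {1..n}"
    "\<forall>a<length \<pi>. \<forall>b<length \<pi>. \<sigma> (xs ! a) < \<sigma> (xs ! b) \<longleftrightarrow> \<pi> ! a < \<pi> ! b"
    by blast
  have "strict_mono_on {..<length \<pi>} (\<lambda>a. xs ! a)"
    using xs(1,2) by (auto simp: strict_mono_on_def sorted_wrt_iff_nth_less)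
  moreover have "(\<lambda>a. xs ! a) ` {..<length \<pi>} \<subseteq> {1..n}"
    using xs(1,3) nth_image[of "length xs" xs] by (simp add: lessThan_atLeast0)
  ultimately show "contains_pattern n \<sigma> \<pi>"
    unfolding contains_pattern_def using xs(4) by blast
qed

lemma contains_123_iff:
  "contains_pattern n \<sigma> [1, 2, 3] \<longleftrightarrow>
     (\<exists>x y z. 1 \<le> x \<and> x < y \<and> y < z \<and> z \<le> n \<and> \<sigma> x < \<sigma> y \<and> \<sigma> y < \<sigma> z)" (is "?L \<longleftrightarrow> ?R")
proof
  assume ?L
  then obtain x y z where "1 \<le> x" "x < y" "y < z" "z \<le> n"
    "\<sigma> x < \<sigma> y" "\<sigma> y < \<sigma> z"
    unfolding contains_pattern_iff_list by (force simp: length_Suc_conv All_less_Suc)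
  then show ?R by blast
next
  assume ?R
  then obtain x y z where "1 \<le> x" "x < y" "y < z" "z \<le> n" "\<sigma> x < \<sigma> y" "\<sigma> y < \<sigma> z" by blast
  then show ?L
    unfolding contains_pattern_iff_list
    by (intro exI[of _ "[x, y, z]"]) (auto simp: All_less_Suc)
qed

lemma contains_312_iff:
  "contains_pattern n \<sigma> [3, 1, 2] \<longleftrightarrow>
     (\<exists>x y z. 1 \<le> x \<and> x < y \<and> y < z \<and> z \<le> n \<and> \<sigma> y < \<sigma> z \<and> \<sigma> z < \<sigma> x)" (is "?L \<longleftrightarrow> ?R")
proof
  assume ?L
  then obtain x y z where "1 \<le> x" "x < y" "y < z" "z \<le> n"
    "\<sigma> y < \<sigma> z" "\<sigma> z < \<sigma> x"
    unfolding contains_pattern_iff_list by (force simp: length_Suc_conv All_less_Suc)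
  then show ?R by blast
next
  assume ?R
  then obtain x y z where "1 \<le> x" "x < y" "y < z" "z \<le> n" "\<sigma> y < \<sigma> z" "\<sigma> z < \<sigma> x" by blast
  then show ?L
    unfolding contains_pattern_iff_list
    by (intro exI[of _ "[x, y, z]"]) (auto simp: All_less_Suc)
qed

lemma contains_3412_iff:
  "contains_pattern n \<sigma> [3, 4, 1, 2] \<longleftrightarrow>
     (\<exists>w x y z. 1 \<le> w \<and> w < x \<and> x < y \<and> y < z \<and> z \<le> n \<and>
        \<sigma> y < \<sigma> z \<and> \<sigma> z < \<sigma> w \<and> \<sigma> w < \<sigma> x)" (is "?L \<longleftrightarrow> ?R")
proof
  assume ?L
  then obtain w x y z where "1 \<le> w" "w < x" "x < y" "y < z" "z \<le> n"
    "\<sigma> y < \<sigma> z" "\<sigma> z < \<sigma> w" "\<sigma> w < \<sigma> x"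
    unfolding contains_pattern_iff_list by (force simp: length_Suc_conv All_less_Suc)
  then show ?R by blast
next
  assume ?R
  then obtain w x y z where "1 \<le> w" "w < x" "x < y" "y < z" "z \<le> n"
    "\<sigma> y < \<sigma> z" "\<sigma> z < \<sigma> w" "\<sigma> w < \<sigma> x" by blast
  then show ?L
    unfolding contains_pattern_iff_list
    by (intro exI[of _ "[w, x, y, z]"]) (auto simp: All_less_Suc)
qed

section \<open>Involutions and reversed intervals\<close>

lemma DI_iff:
  "\<sigma> \<in> DI n \<longleftrightarrow> (\<forall>i. \<sigma> (\<sigma> i) = i) \<and> (\<forall>i. i \<notin> {1..n} \<longrightarrow> \<sigma> i = i) \<and> (\<forall>i\<in>{1..n}. \<sigma> i \<noteq> i)"
  unfolding DI_def permutes_def by (auto simp: fun_eq_iff) metis+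

lemma DI_in_range:
  assumes "\<sigma> \<in> DI n" "1 \<le> i" "i \<le> n"
  shows "1 \<le> \<sigma> i" "\<sigma> i \<le> n"
  using assms permutes_in_image[of \<sigma> "{1..n}" i] by (auto simp: DI_def)

lemma DI_eq_iff: "\<sigma> \<in> DI n \<Longrightarrow> \<sigma> i = \<sigma> j \<longleftrightarrow> i = j"
  by (metis DI_iff)

text \<open>A decreasing map loses at least 1 at each step, so counting from the left end bounds
  \<open>f i\<close> above and counting from the right end bounds it below by the same number.\<close>

lemma decreasing_self_map_is_reversal:
  fixes f :: "nat \<Rightarrow> nat"
  assumes into: "\<And>i. a < i \<Longrightarrow> i \<le> b \<Longrightarrow> a < f i \<and> f i \<le> b"
    and decr: "\<And>i j. a < i \<Longrightarrow> i < j \<Longrightarrow> j \<le> b \<Longrightarrow> f j < f i"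
    and i: "a < i" "i \<le> b"
  shows "f i = a + b + 1 - i"
proof -
  have upper: "a < j \<Longrightarrow> j \<le> b \<Longrightarrow> f j + j \<le> a + b + 1" for j
  proof (induction j)
    case (Suc j)
    then show ?case
      using into[of "Suc j"] decr[of j "Suc j"] by (cases "j = a") auto
  qed simp
  have lower: "d < b - a \<Longrightarrow> a + d + 1 \<le> f (b - d)" for d
  proof (induction d)
    case 0
    then show ?case using into[of b] by simp
  next
    case (Suc d)
    moreover have "a < b - Suc d" "b - Suc d < b - d" using Suc.prems by arith+
    ultimately show ?case using decr[of "b - Suc d" "b - d"] by simp
  qed
  have "b - i < b - a" using i by arith
  then show ?thesis using upper[of i] lower[of "b - i"] i by simp
qed

definition reverse_interval :: "nat \<Rightarrow> nat \<Rightarrow> (nat \<Rightarrow> nat) \<Rightarrow> nat \<Rightarrow> nat" where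
  "reverse_interval a b \<tau> i = (if a < i \<and> i \<le> b then a + b + 1 - i else \<tau> i)"

text \<open>An interval of odd length has a middle point, which its reversal fixes.\<close>

lemma reversal_without_fixed_point_even:
  fixes f :: "nat \<Rightarrow> nat"
  assumes "\<And>i. a < i \<Longrightarrow> i \<le> b \<Longrightarrow> f i = a + b + 1 - i \<and> f i \<noteq> i" "a < b"
  shows "even (a + b)"
proof (rule ccontr)
  assume "odd (a + b)"
  then have "even (a + b + 1)" by simp
  then obtain c where c: "a + b + 1 = 2 * c" by (elim dvdE)
  with assms(1)[of c] \<open>a < b\<close> show False by simp
qed

section \<open>Avoiding 3412 and 123\<close>

text \<open>The three layers: \<open>k\<close> outer arcs, and inside them two reversed intervals that meet at
  \<open>2c - k\<close>. The first has centre \<open>c + 1/2\<close>; for \<open>c = h\<close> the second is empty and the whole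
  permutation is the reversal of \<open>{1..2h}\<close>.\<close>

definition two_nests :: "nat \<Rightarrow> nat \<Rightarrow> nat \<Rightarrow> nat \<Rightarrow> nat" where
  "two_nests h k c =
     reverse_interval k (2 * c - k) (reverse_interval (2 * c - k) (2 * h - k)
       (reverse_interval 0 (2 * h) id))"

text \<open>The values of \<open>two_nests\<close> without subtraction: on each layer the sum of a point and its
  partner is constant, so everything below is linear arithmetic on these sums.\<close>

lemma two_nests_cases:
  assumes "k \<le> c" "c \<le> h"
  obtains (outside) "i \<notin> {1..2 * h}" "two_nests h k c i = i"
    | (outer) "1 \<le> i" "i \<le> 2 * h" "i \<le> k \<or> 2 * h < i + k" "two_nests h k c i + i = 2 * h + 1"
    | (first) "k < i" "i + k \<le> 2 * c" "two_nests h k c i + i = 2 * c + 1"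
    | (second) "2 * c < i + k" "i + k \<le> 2 * h" "two_nests h k c i + i + 2 * k = 2 * c + 2 * h + 1"
proof -
  consider "i \<notin> {1..2 * h}" | "1 \<le> i" "i \<le> 2 * h" "i \<le> k \<or> 2 * h < i + k"
    | "k < i" "i + k \<le> 2 * c" | "2 * c < i + k" "i + k \<le> 2 * h"
    using assms by fastforce
  then show thesis
  proof cases
    case 1
    moreover have "two_nests h k c i = i"
      using 1 assms by (auto simp: two_nests_def reverse_interval_def)
    ultimately show thesis by (rule outside)
  next
    case 2
    moreover have "two_nests h k c i + i = 2 * h + 1"
      using 2 assms unfolding two_nests_def reverse_interval_def by auto
    ultimately show thesis by (rule outer)
  next
    case 3
    moreover have "two_nests h k c i + i = 2 * c + 1"
      using 3 assms unfolding two_nests_def reverse_interval_def by simp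
    ultimately show thesis by (rule first)
  next
    case 4
    moreover have "two_nests h k c i + i + 2 * k = 2 * c + 2 * h + 1"
      using 4 assms unfolding two_nests_def reverse_interval_def by auto
    ultimately show thesis by (rule second)
  qed
qed

lemma two_nests_in_DI:
  assumes "k \<le> c" "c \<le> h"
  shows "two_nests h k c \<in> DI (2 * h)"
  unfolding DI_iff
proof (intro conjI allI ballI impI)
  fix i
  note cases_of = two_nests_cases[OF assms]
  show "two_nests h k c (two_nests h k c i) = i"
    using assms
    by (cases rule: cases_of[of i]; cases rule: cases_of[of "two_nests h k c i"]) (simp; linarith)+
  show "two_nests h k c i = i" if "i \<notin> {1..2 * h}"
    using that assms by (cases rule: cases_of[of i]) auto
  show "two_nests h k c i \<noteq> i" if "i \<in> {1..2 * h}"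
  proof
    assume "two_nests h k c i = i"
    with that show False by (cases rule: cases_of[of i]) (simp; presburger)+
  qed
qed

text \<open>Leaving out either of the two inner intervals makes the permutation decreasing. So an ascent
  goes from the first to the second interval; two ascents that share their middle point, or that
  follow one another, cannot both pass the same cut, which excludes 123 and 3412.\<close>

lemma two_nests_ascent_straddles:
  assumes "k \<le> c" "c \<le> h" "1 \<le> i" "i < j" "j \<le> 2 * h"
    and "two_nests h k c i < two_nests h k c j"
  shows "i + k \<le> 2 * c" "2 * c < j + k"
proof -
  note cases_of = two_nests_cases[OF assms(1,2)]
  have "i + k \<le> 2 * c \<and> 2 * c < j + k"
    using assms by (cases rule: cases_of[of i]; cases rule: cases_of[of j]) (simp; linarith)+
  then show "i + k \<le> 2 * c" "2 * c < j + k" by auto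
qed

lemma two_nests_avoids:
  assumes "k \<le> c" "c \<le> h"
  shows "two_nests h k c \<in> DI_avoiding (2 * h) [3, 4, 1, 2] [1, 2, 3]"
proof -
  note straddle = two_nests_ascent_straddles[OF assms]
  have "\<not> contains_pattern (2 * h) (two_nests h k c) [1, 2, 3]"
    unfolding contains_123_iff
  proof clarify
    fix x y z
    assume *: "1 \<le> x" "x < y" "y < z" "z \<le> 2 * h"
      "two_nests h k c x < two_nests h k c y" "two_nests h k c y < two_nests h k c z"
    show False using straddle(2)[of x y] straddle(1)[of y z] * by linarith
  qed
  moreover have "\<not> contains_pattern (2 * h) (two_nests h k c) [3, 4, 1, 2]"
    unfolding contains_3412_iff
  proof clarify
    fix w x y z
    assume *: "1 \<le> w" "w < x" "x < y" "y < z" "z \<le> 2 * h"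
      "two_nests h k c w < two_nests h k c x" "two_nests h k c y < two_nests h k c z"
    show False using straddle(2)[of w x] straddle(1)[of y z] * by linarith
  qed
  ultimately show ?thesis
    using two_nests_in_DI[OF assms] by (simp add: DI_avoiding_def avoids_pattern_def)
qed

lemma avoiding_3412_123_is_two_nests:
  assumes "\<sigma> \<in> DI_avoiding (2 * h) [3, 4, 1, 2] [1, 2, 3]"
  shows "\<sigma> = two_nests h 0 h \<or> (\<exists>k c. k < c \<and> c < h \<and> \<sigma> = two_nests h k c)"
proof (cases "\<exists>k<2 * h. \<sigma> (k + 1) \<noteq> 2 * h - k")
  case False
  have DI: "\<sigma> \<in> DI (2 * h)" using assms by (simp add: DI_avoiding_def)
  have "\<sigma> i = two_nests h 0 h i" for i
  proof (cases "i \<in> {1..2 * h}")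
    case True
    then have "i - 1 < 2 * h" by auto
    then show ?thesis using False[simplified, rule_format, of "i - 1"] True
      by (simp add: two_nests_def reverse_interval_def)
  next
    case False
    then show ?thesis using DI by (auto simp: two_nests_def reverse_interval_def DI_iff)
  qed
  then show ?thesis by blast
next
  case True
  \<comment> \<open>The number of outer arcs: \<open>k + 1\<close> is the first point not matched as in the full reversal.\<close>
  define k where "k = (LEAST k. k < 2 * h \<and> \<sigma> (k + 1) \<noteq> 2 * h - k)"
  have k: "k < 2 * h" "\<sigma> (k + 1) \<noteq> 2 * h - k"
    using LeastI_ex[OF True[unfolded Bex_def]] by (simp_all add: k_def)
  have DI: "\<sigma> \<in> DI (2 * h)" using assms by (simp add: DI_avoiding_def)
  have inv: "\<sigma> (\<sigma> i) = i" for i using DI by (simp add: DI_iff)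
  have nofix: "\<sigma> i \<noteq> i" if "1 \<le> i" "i \<le> 2 * h" for i using DI that by (simp add: DI_iff)
  note range = DI_in_range[OF DI]
  have left: "\<sigma> i = 2 * h + 1 - i" if "1 \<le> i" "i \<le> k" for i
    using not_less_Least[of "i - 1" "\<lambda>k. k < 2 * h \<and> \<sigma> (k + 1) \<noteq> 2 * h - k"] that k(1)
    by (auto simp: k_def)
  have "k < h"
  proof (rule ccontr)
    assume "\<not> k < h"
    then have "\<sigma> (2 * h - k) = k + 1" using left[of "2 * h - k"] k(1) by simp
    then show False using inv[of "2 * h - k"] k(2) by simp
  qed
  define r where "r = 2 * h - k"
  have r: "r + k = 2 * h" "k < r" using \<open>k < h\<close> by (simp_all add: r_def)
  have right: "\<sigma> i = 2 * h + 1 - i" if "r < i" "i \<le> 2 * h" for i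
  proof -
    have "1 \<le> 2 * h + 1 - i" "2 * h + 1 - i \<le> k" using that r(1) by linarith+
    then show ?thesis using inv[of "2 * h + 1 - i"] left[of "2 * h + 1 - i"] that by simp
  qed
  have middle: "k < \<sigma> i \<and> \<sigma> i \<le> r" if "k < i" "i \<le> r" for i
  proof -
    have *: "1 \<le> \<sigma> i" "\<sigma> i \<le> 2 * h" using range[of i] that r(1) by auto
    have "\<not> \<sigma> i \<le> k" using left[of "\<sigma> i"] inv[of i] * that r(1) by linarith
    moreover have "\<not> r < \<sigma> i" using right[of "\<sigma> i"] inv[of i] * that r(1) by linarith
    ultimately show ?thesis by simp
  qed
  define q where "q = \<sigma> (k + 1)"
  have \<sigma>k: "\<sigma> (k + 1) = q" and \<sigma>q: "\<sigma> q = k + 1" using inv by (simp_all add: q_def)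
  have q: "k + 1 < q" "q < r"
    using middle[of "k + 1"] k nofix[of "k + 1"] r unfolding \<sigma>k r_def[symmetric] by simp_all
  have no123: False
    if "1 \<le> x" "x < y" "y < z" "z \<le> 2 * h" "\<sigma> x < \<sigma> y" "\<sigma> y < \<sigma> z" for x y z
    using assms that
    unfolding DI_avoiding_def avoids_pattern_def contains_123_iff by blast
  \<comment> \<open>Otherwise the arc between \<open>k + 1\<close> and \<open>q\<close> crosses the one between \<open>i\<close> and its partner.\<close>
  have second: "q < \<sigma> i \<and> \<sigma> i \<le> r" if "q < i" "i \<le> r" for i
  proof (rule ccontr)
    assume "\<not> ?thesis"
    moreover have "k < \<sigma> i" "\<sigma> i \<le> r" using middle[of i] that q by simp_all
    moreover have "\<sigma> i \<noteq> q" "\<sigma> i \<noteq> k + 1"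
      using inv[of i] \<sigma>q \<sigma>k that q by auto
    ultimately have "\<sigma> i < q" "k + 1 < \<sigma> i" by simp_all
    then have "contains_pattern (2 * h) \<sigma> [3, 4, 1, 2]"
      unfolding contains_3412_iff using that q \<sigma>q \<sigma>k inv[of i] r
      by (intro exI[of _ "k + 1"] exI[of _ "\<sigma> i"] exI[of _ q] exI[of _ i]) simp
    with assms show False by (simp add: DI_avoiding_def avoids_pattern_def)
  qed
  have first: "k < \<sigma> i \<and> \<sigma> i \<le> q" if "k < i" "i \<le> q" for i
    using middle[of i] second[of "\<sigma> i"] inv[of i] that q by (cases "\<sigma> i \<le> q") simp_all
  have first_rev: "\<sigma> i = k + q + 1 - i" if "k < i" "i \<le> q" for i
  proof (rule decreasing_self_map_is_reversal[OF first])
    fix i j assume ij: "k < i" "i < j" "j \<le> q"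
    show "\<sigma> j < \<sigma> i"
    proof (rule ccontr)
      assume "\<not> \<sigma> j < \<sigma> i"
      then have "\<sigma> i < \<sigma> j" using ij DI_eq_iff[OF DI, of i j] by simp
      then show False using no123[of i j "q + 1"] first[of j] second[of "q + 1"] ij q r(1) by simp
    qed
  qed (use that in auto)
  have second_rev: "\<sigma> i = q + r + 1 - i" if "q < i" "i \<le> r" for i
  proof (rule decreasing_self_map_is_reversal[OF second])
    fix i j assume ij: "q < i" "i < j" "j \<le> r"
    show "\<sigma> j < \<sigma> i"
    proof (rule ccontr)
      assume "\<not> \<sigma> j < \<sigma> i"
      then have "\<sigma> i < \<sigma> j" using ij DI_eq_iff[OF DI, of i j] by simp
      then show False using no123[of q i j] first[of q] second[of i] ij q r(1) by simp
    qed
  qed (use that in auto)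
  \<comment> \<open>Parity makes the centre of the first interval of the form \<open>c + 1/2\<close> with an integer \<open>c\<close>.\<close>
  have "even (k + q)"
  proof (rule reversal_without_fixed_point_even)
    fix i assume "k < i" "i \<le> q"
    then show "\<sigma> i = k + q + 1 - i \<and> \<sigma> i \<noteq> i"
      using first_rev[of i] nofix[of i] q r(1) by simp
  qed (use q in simp)
  then obtain c where c: "k + q = 2 * c" by (elim dvdE)
  then have kch: "k < c" "c < h" using q r by linarith+
  then have le: "k \<le> c" "c \<le> h" by simp_all
  have "\<sigma> i = two_nests h k c i" for i
  proof (cases rule: two_nests_cases[OF le, of i])
    case 1
    then show ?thesis using DI by (simp add: DI_iff)
  next
    case 2
    then have "\<sigma> i = 2 * h + 1 - i" using left[of i] right[of i] r(1) by auto
    then show ?thesis using 2 by simp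
  next
    case 3
    then show ?thesis using first_rev[of i] c by simp
  next
    case 4
    then show ?thesis using second_rev[of i] c r(1) by simp
  qed
  then show ?thesis using kch by blast
qed

text \<open>The number \<open>k\<close> of outer arcs is read off as the first place where the permutation differs
  from the full reversal; this also separates the full reversal, \<open>c' = h\<close>, from the rest.\<close>

lemma two_nests_outer_le:
  assumes "two_nests h k c = two_nests h k' c'" "k < c" "c < h" "k' \<le> c'" "c' \<le> h"
  shows "k' \<le> k" "c' < h"
proof -
  have "two_nests h k' c' (k + 1) + (k + 1) = 2 * c + 1"
    using assms(2,3) unfolding assms(1)[symmetric]
    by (simp add: two_nests_def reverse_interval_def)
  then have "k' \<le> k \<and> c' < h"
    using assms(2-5) by (cases rule: two_nests_cases[OF assms(4,5), of "k + 1"]) auto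
  then show "k' \<le> k" "c' < h" by auto
qed

lemma two_nests_inj:
  assumes "two_nests h k c = two_nests h k' c'" "k < c" "c < h" "k' < c'" "c' < h"
  shows "k = k' \<and> c = c'"
proof -
  have "k = k'"
    using two_nests_outer_le(1)[OF assms(1)] two_nests_outer_le(1)[OF assms(1)[symmetric]] assms
    by simp
  moreover have "two_nests h k c (k + 1) = 2 * c - k" "two_nests h k' c' (k' + 1) = 2 * c' - k'"
    using assms(2-5) by (simp_all add: two_nests_def reverse_interval_def)
  ultimately show ?thesis using assms by auto
qed

theorem card_avoiding_3412_123:
  "card (DI_avoiding (2 * h) [3, 4, 1, 2] [1, 2, 3]) = 1 + (h choose 2)"
proof -
  define P where "P = (SIGMA c:{..<h}. {..<c})"
  have set_eq: "DI_avoiding (2 * h) [3, 4, 1, 2] [1, 2, 3]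
      = insert (two_nests h 0 h) ((\<lambda>(c, k). two_nests h k c) ` P)" (is "_ = insert _ ?I")
  proof (intro equalityI subsetI)
    fix \<sigma> assume "\<sigma> \<in> DI_avoiding (2 * h) [3, 4, 1, 2] [1, 2, 3]"
    then consider "\<sigma> = two_nests h 0 h" | k c where "k < c" "c < h" "\<sigma> = two_nests h k c"
      using avoiding_3412_123_is_two_nests by blast
    then show "\<sigma> \<in> insert (two_nests h 0 h) ?I"
    proof cases
      case (2 k c)
      then have "\<sigma> \<in> ?I" by (intro image_eqI[of _ _ "(c, k)"]) (simp_all add: P_def)
      then show ?thesis by blast
    qed simp
  next
    fix \<sigma> assume "\<sigma> \<in> insert (two_nests h 0 h) ?I"
    then consider "\<sigma> = two_nests h 0 h" | k c where "k < c" "c < h" "\<sigma> = two_nests h k c"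
      by (auto simp: P_def)
    then show "\<sigma> \<in> DI_avoiding (2 * h) [3, 4, 1, 2] [1, 2, 3]"
      by cases (use two_nests_avoids in \<open>metis le0 le_refl less_imp_le\<close>)+
  qed
  have inj: "inj_on (\<lambda>(c, k). two_nests h k c) P"
  proof (rule inj_onI)
    fix p p' assume *: "p \<in> P" "p' \<in> P"
      "(case p of (c, k) \<Rightarrow> two_nests h k c) = (case p' of (c, k) \<Rightarrow> two_nests h k c)"
    obtain c k c' k' where "p = (c, k)" "p' = (c', k')" by (cases p, cases p') blast
    with * show "p = p'" using two_nests_inj[of h k c k' c'] by (simp add: P_def)
  qed
  have new: "two_nests h 0 h \<notin> (\<lambda>(c, k). two_nests h k c) ` P"
  proof
    assume "two_nests h 0 h \<in> (\<lambda>(c, k). two_nests h k c) ` P"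
    then obtain c k where "k < c" "c < h" "two_nests h k c = two_nests h 0 h"
      by (auto simp: P_def)
    then show False using two_nests_outer_le(2)[of h k c 0 h] by simp
  qed
  have "finite P" by (simp add: P_def)
  have "card P = h choose 2"
  proof -
    have "card P = \<Sum>{..<h}" by (simp add: P_def)
    also have "\<dots> = h choose 2"
      by (induction h) (simp_all add: numeral_2_eq_2)
    finally show ?thesis .
  qed
  then show ?thesis
    unfolding set_eq using new \<open>finite P\<close> by (simp add: card_image[OF inj])
qed

section \<open>Avoiding 3412 and 312\<close>

lemma contains_3412_imp_312:
  "contains_pattern n \<sigma> [3, 4, 1, 2] \<Longrightarrow> contains_pattern n \<sigma> [3, 1, 2]"
  unfolding contains_3412_iff contains_312_iff by (meson less_trans)

definition DI312 :: "nat \<Rightarrow> (nat \<Rightarrow> nat) set" where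
  "DI312 n = {\<sigma> \<in> DI n. avoids_pattern n \<sigma> [3, 1, 2]}"

lemma DI312_no_312:
  assumes "\<sigma> \<in> DI312 n" "1 \<le> x" "x < y" "y < z" "z \<le> n" "\<sigma> y < \<sigma> z" "\<sigma> z < \<sigma> x"
  shows False
  using assms unfolding DI312_def avoids_pattern_def contains_312_iff by blast

lemma DI312I:
  assumes "\<sigma> \<in> DI n"
    and "\<And>x y z. 1 \<le> x \<Longrightarrow> x < y \<Longrightarrow> y < z \<Longrightarrow> z \<le> n \<Longrightarrow> \<sigma> y < \<sigma> z \<Longrightarrow> \<sigma> z < \<sigma> x \<Longrightarrow> False"
  shows "\<sigma> \<in> DI312 n"
  using assms unfolding DI312_def avoids_pattern_def contains_312_iff by blast

text \<open>Behind \<open>m\<close> the permutation is decreasing and has larger values than before \<open>m\<close>, so an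
  occurrence of 312 that ends behind \<open>m\<close> would have its ascent there.\<close>

lemma reverse_interval_in_DI312:
  assumes \<tau>: "\<tau> \<in> DI312 m" and "m < n" and "even (m + n)"
  shows "reverse_interval m n \<tau> \<in> DI312 n"
proof (rule DI312I)
  have DI: "\<tau> \<in> DI m" using \<tau> by (simp add: DI312_def)
  have big: "\<tau> i = i" if "m < i" for i
    using DI that by (simp add: DI_iff)
  have small: "\<tau> i \<le> m" if "i \<le> m" for i
    using DI_in_range(2)[OF DI, of i] DI that by (cases "i = 0") (auto simp: DI_iff)
  show "reverse_interval m n \<tau> \<in> DI n"
    unfolding DI_iff
  proof (intro conjI allI ballI impI)
    fix i
    show "reverse_interval m n \<tau> (reverse_interval m n \<tau> i) = i"
      using DI small[of i] big[of i] by (cases "i \<le> m") (auto simp: reverse_interval_def DI_iff)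
    show "reverse_interval m n \<tau> i = i" if "i \<notin> {1..n}"
      using DI that \<open>m < n\<close> by (auto simp: reverse_interval_def DI_iff)
    show "reverse_interval m n \<tau> i \<noteq> i" if "i \<in> {1..n}"
    proof
      assume *: "reverse_interval m n \<tau> i = i"
      have "m < i" using * DI that by (auto simp: reverse_interval_def DI_iff split: if_splits)
      then have "m + n + 1 = 2 * i" using * that by (simp add: reverse_interval_def)
      with \<open>even (m + n)\<close> show False by presburger
    qed
  qed
  fix x y z
  assume *: "1 \<le> x" "x < y" "y < z" "z \<le> n"
    "reverse_interval m n \<tau> y < reverse_interval m n \<tau> z"
    "reverse_interval m n \<tau> z < reverse_interval m n \<tau> x"
  show False
  proof (cases "z \<le> m")
    case True
    then show False using * DI312_no_312[OF \<tau>, of x y z] by (simp add: reverse_interval_def)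
  next
    case False
    then show False using * small[of x] small[of y]
      by (auto simp: reverse_interval_def split: if_splits)
  qed
qed

text \<open>With \<open>n\<close> matched to \<open>m + 1\<close>, the value \<open>n\<close> at position \<open>m + 1\<close> plays the role of 3 in
  two ways: with the value \<open>m + 1\<close> at position \<open>n\<close> as 2, which keeps \<open>{m<..n}\<close> invariant, and
  with any ascent to the right of it, which makes \<open>{m<..n}\<close> reversed.\<close>

lemma DI312_last_interval:
  assumes \<sigma>: "\<sigma> \<in> DI312 n" and "0 < n"
  obtains m \<tau> where "m < n" "even (m + n)" "\<tau> \<in> DI312 m" "\<sigma> = reverse_interval m n \<tau>"
proof -
  have DI: "\<sigma> \<in> DI n" using \<sigma> by (simp add: DI312_def)
  have inv: "\<sigma> (\<sigma> i) = i" for i using DI by (simp add: DI_iff)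
  have nofix: "\<sigma> i \<noteq> i" if "1 \<le> i" "i \<le> n" for i using DI that by (simp add: DI_iff)
  note range = DI_in_range[OF DI]
  define m where "m = \<sigma> n - 1"
  have \<sigma>n: "\<sigma> n = m + 1" "m + 1 < n"
    using range[of n] nofix[of n] \<open>0 < n\<close> by (auto simp: m_def)
  then have \<sigma>m: "\<sigma> (m + 1) = n" using inv[of n] by simp
  have block: "m < \<sigma> i \<and> \<sigma> i \<le> n" if "m < i" "i \<le> n" for i
  proof (cases "i = m + 1 \<or> i = n")
    case True
    then show ?thesis using \<sigma>n \<sigma>m by auto
  next
    case False
    then show ?thesis
      using DI312_no_312[OF \<sigma>, of "m + 1" i n] that \<sigma>n \<sigma>m range[of i] by fastforce
  qed
  have rev: "\<sigma> i = m + n + 1 - i" if "m < i" "i \<le> n" for i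
  proof (rule decreasing_self_map_is_reversal[OF block])
    fix i j assume ij: "m < i" "i < j" "j \<le> n"
    have "\<sigma> j \<noteq> \<sigma> i" "\<sigma> j \<noteq> n" "\<sigma> j \<le> n"
      using ij DI_eq_iff[OF DI, of j i] DI_eq_iff[OF DI, of j "m + 1"] \<sigma>m block[of j] by auto
    then show "\<sigma> j < \<sigma> i"
      using ij DI312_no_312[OF \<sigma>, of "m + 1" i j] \<sigma>m
      by (cases "i = m + 1") fastforce+
  qed (use that in auto)
  define \<tau> where "\<tau> i = (if i \<le> m then \<sigma> i else i)" for i
  have small: "\<sigma> i \<le> m" if "i \<le> m" for i
    using that block[of "\<sigma> i"] inv[of i] range(2)[of i] DI \<sigma>n
    by (cases "i = 0") (fastforce simp: DI_iff)+
  have \<tau>: "\<tau> \<in> DI312 m"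
  proof (rule DI312I)
    show "\<tau> \<in> DI m" using DI small \<sigma>n by (auto simp: DI_iff \<tau>_def)
    fix x y z assume "1 \<le> x" "x < y" "y < z" "z \<le> m" "\<tau> y < \<tau> z" "\<tau> z < \<tau> x"
    then show False using DI312_no_312[OF \<sigma>, of x y z] \<sigma>n by (simp add: \<tau>_def)
  qed
  have \<sigma>_eq: "\<sigma> = reverse_interval m n \<tau>"
    using rev DI by (auto simp: fun_eq_iff reverse_interval_def \<tau>_def DI_iff)
  have ev: "even (m + n)"
  proof (rule reversal_without_fixed_point_even)
    fix i assume "m < i" "i \<le> n"
    then show "\<sigma> i = m + n + 1 - i \<and> \<sigma> i \<noteq> i" using rev[of i] nofix[of i] by simp
  qed (use \<sigma>n in simp)
  show ?thesis by (rule that[OF _ ev \<tau> \<sigma>_eq]) (use \<sigma>n in simp)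
qed

text \<open>The last interval has even length, so on \<open>{1..2h}\<close> it leaves a set \<open>{1..2j}\<close> with \<open>j < h\<close>,
  on which the matching is arbitrary.\<close>

lemma DI312_decomposition:
  assumes "0 < h"
  shows "DI312 (2 * h) = (\<Union>j<h. reverse_interval (2 * j) (2 * h) ` DI312 (2 * j))"
proof (intro equalityI subsetI)
  fix \<sigma> assume "\<sigma> \<in> DI312 (2 * h)"
  then obtain m \<tau> where *: "m < 2 * h" "even (m + 2 * h)" "\<tau> \<in> DI312 m"
    "\<sigma> = reverse_interval m (2 * h) \<tau>"
    using DI312_last_interval[of \<sigma> "2 * h"] assms by auto
  then obtain j where "m = 2 * j" by (auto elim: dvdE)
  with * show "\<sigma> \<in> (\<Union>j<h. reverse_interval (2 * j) (2 * h) ` DI312 (2 * j))" by auto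
qed (auto intro: reverse_interval_in_DI312)

lemma finite_DI312: "finite (DI312 n)"
  by (rule finite_subset[OF _ finite_permutations[of "{1..n}"]]) (auto simp: DI312_def DI_def)

lemma inj_on_reverse_interval: "inj_on (reverse_interval m n) (DI312 m)"
proof (rule inj_onI)
  fix \<tau> \<tau>' assume *: "\<tau> \<in> DI312 m" "\<tau>' \<in> DI312 m" "reverse_interval m n \<tau> = reverse_interval m n \<tau>'"
  show "\<tau> = \<tau>'"
  proof
    fix i
    have "\<tau> i = i" "\<tau>' i = i" if "m < i" using * that by (auto simp: DI312_def DI_iff)
    moreover have "\<tau> i = \<tau>' i" if "i \<le> m"
      using fun_cong[OF *(3), of i] that by (simp add: reverse_interval_def)
    ultimately show "\<tau> i = \<tau>' i" by (cases "i \<le> m") auto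
  qed
qed

lemma card_DI312_sum:
  assumes "0 < h"
  shows "card (DI312 (2 * h)) = (\<Sum>j<h. card (DI312 (2 * j)))"
proof -
  \<comment> \<open>The value at \<open>2h\<close> tells where the last interval starts.\<close>
  have "reverse_interval (2 * i) (2 * h) ` A \<inter> reverse_interval (2 * j) (2 * h) ` B = {}"
    if "i < h" "j < h" "i \<noteq> j" for i j and A B :: "(nat \<Rightarrow> nat) set"
  proof -
    have last: "reverse_interval (2 * l) (2 * h) \<tau> (2 * h) = 2 * l + 1" if "l < h" for l \<tau>
      using that by (simp add: reverse_interval_def)
    have "reverse_interval (2 * i) (2 * h) \<tau> \<noteq> reverse_interval (2 * j) (2 * h) \<tau>'" for \<tau> \<tau>'
    proof
      assume "reverse_interval (2 * i) (2 * h) \<tau> = reverse_interval (2 * j) (2 * h) \<tau>'"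
      then have "2 * i + 1 = 2 * j + 1" using last \<open>i < h\<close> \<open>j < h\<close> by metis
      with \<open>i \<noteq> j\<close> show False by simp
    qed
    then show ?thesis by blast
  qed
  then have "card (DI312 (2 * h)) =
      (\<Sum>j<h. card (reverse_interval (2 * j) (2 * h) ` DI312 (2 * j)))"
    unfolding DI312_decomposition[OF assms]
    by (intro card_UN_disjoint) (auto simp: finite_DI312)
  then show ?thesis by (simp add: card_image inj_on_reverse_interval)
qed

lemma DI312_0: "DI312 0 = {id}"
  unfolding DI312_def avoids_pattern_def contains_312_iff by (auto simp: DI_iff)

text \<open>The sum for \<open>Suc (Suc h)\<close> is the sum for \<open>Suc h\<close> plus one term equal to that sum.\<close>

lemma card_DI312: "card (DI312 (2 * Suc h)) = 2 ^ h"
proof (induction h)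
  case 0
  show ?case using card_DI312_sum[of 1] by (simp add: DI312_0)
next
  case (Suc h)
  show ?case
    using card_DI312_sum[of "Suc (Suc h)"] card_DI312_sum[of "Suc h"] Suc.IH
    by simp
qed

theorem card_avoiding_3412_312:
  assumes "1 \<le> h"
  shows "card (DI_avoiding (2 * h) [3, 4, 1, 2] [3, 1, 2]) = 2 ^ (h - 1)"
proof -
  have "DI_avoiding (2 * h) [3, 4, 1, 2] [3, 1, 2] = DI312 (2 * h)"
    using contains_3412_imp_312 by (auto simp: DI_avoiding_def DI312_def avoids_pattern_def)
  then show ?thesis using card_DI312[of "h - 1"] assms by simp
qed

theorem theorem12:
  fixes h :: nat
  assumes "h \<ge> 1"
  shows "card (DI_avoiding (2 * h) [3, 4, 1, 2] [1, 2, 3]) = 1 + (h choose 2) \<and>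
         card (DI_avoiding (2 * h) [3, 4, 1, 2] [3, 1, 2]) = 2 ^ (h - 1)"
  using card_avoiding_3412_123 card_avoiding_3412_312[OF assms] by simp

end
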